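(* Let $d\ge 2$, $1\le j\le d$, and let $\mathcal{S}_1,\dots,\mathcal{S}_n$ be $d$-tuples of polynomials in $\mathbb{R}[x_1,\dots,x_d]$ such that $T_{[x_j]}(\mathcal{S}_1)\le T_{[x_j]}(\mathcal{S}_2)\le\cdots\le T_{[x_j]}(\mathcal{S}_n)$ is a chain of sub-expansions of the expansion $T_{[x_j]}(\mathcal{S}_n)$. Then, for each index $k$ of the chain, $$\sum_{i=k+1}^{n}\big[T_{[x_j]}(\mathcal{S}_i):T_{[x_j]}(\mathcal{S}_{i-1})\big]<\mathbb{D}\big[T_{[x_j]}(\mathcal{S}_k)\,\big|\,T_{[x_j]}(\mathcal{S}_n)\big]+(n-k).$$
   Context: Tuples are $d$-tuples $\mathcal{S}=(f_1,\dots,f_d)$ of polynomials in $\mathbb{R}[x_1,\dots,x_d]$, $d\ge2$. The expansion in the direction $x_j$ is the operator $T_{[x_j]}:=(\gamma^{-1}\circ\beta\circ\gamma\circ\nabla)_{[x_j]}$, where $\nabla_{[x_j]}(\mathcal{S})=(\partial f_1/\partial x_j,\dots,\partial f_d/\partial x_j)$, $\gamma$ turns a tuple into a column vector and $\beta$ multiplies by the $d\times d$ matrix with $0$ on the diagonal and $1$ elsewhere; so the $r$-th entry of $T_{[x_j]}(\mathcal{S})$ is $\sum_{t\ne r}\partial f_t/\partial x_j$. $T_{[x_j]}^k$ is the $k$-fold iterate. Sub-expansion: $T_{[x_j]}^k(\mathcal{S}_z)\le T_{[x_j]}^l(\mathcal{S}_t)$ means there exists some $m\ge 0$ with $T_{[x_j]}^k(\mathcal{S}_z)=T_{[x_j]}^{k+m}(\mathcal{S}_t)$.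 Index: $[T_{[x_j]}(\mathcal{S}_t):T_{[x_j]}(\mathcal{S}_z)]$ is the value of $r\in\mathbb{N}$ such that $T_{[x_j]}(\mathcal{S}_z)=T_{[x_j]}^r(\mathcal{S}_t)$ (and is $\infty$ if no such $r$ exists). Dominating number: if $T_{[x_j]}(\mathcal{S}_z)\le T_{[x_j]}(\mathcal{S}_t)$, then $\mathbb{D}[T_{[x_j]}(\mathcal{S}_z)\,|\,T_{[x_j]}(\mathcal{S}_t)]$ is the smallest $s\in\mathbb{N}$ such that $T_{[x_j]}^s(\mathcal{S}_t)\le T_{[x_j]}(\mathcal{S}_z)$. *)

theory Defs
  imports "HOL-Analysis.Cartesian_Space" "HOL-Library.Poly_Mapping" "HOL-Library.Extended_Nat"
begin

text \<open>
  Both the variables and the entries of a tuple are indexed by the finite type \<open>'d\<close>, so that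
  \<open>d\<close> is \<open>CARD('d)\<close>. A monomial is its exponent vector, a polynomial the finitely supported
  family of its coefficients.
\<close>

type_synonym 'd rpoly = "('d \<Rightarrow>\<^sub>0 nat) \<Rightarrow>\<^sub>0 real"

type_synonym 'd tuple = "'d \<Rightarrow> 'd rpoly"

text \<open>
  The subtraction of exponent vectors truncates at \<open>0\<close>; this only affects monomials not
  containing the variable \<open>x\<^sub>j\<close>, whose contribution has coefficient \<open>0\<close>.
\<close>

definition partial_deriv :: "'d \<Rightarrow> 'd rpoly \<Rightarrow> 'd rpoly" where
  "partial_deriv j f =
     (\<Sum>a\<in>Poly_Mapping.keys f.
        Poly_Mapping.single (a - Poly_Mapping.single j 1)
          (real (Poly_Mapping.lookup a j) * Poly_Mapping.lookup f a))"

lemma lookup_partial_deriv: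
  "Poly_Mapping.lookup (partial_deriv j f) a =
     real (Poly_Mapping.lookup a j + 1) * Poly_Mapping.lookup f (a + Poly_Mapping.single j 1)"
proof -
  let ?b = "a + Poly_Mapping.single j 1"
  have term_eq: "Poly_Mapping.lookup
      (Poly_Mapping.single (c - Poly_Mapping.single j 1)
         (real (Poly_Mapping.lookup c j) * Poly_Mapping.lookup f c)) a =
      (if c = ?b then real (Poly_Mapping.lookup a j + 1) * Poly_Mapping.lookup f ?b else 0)" for c
  proof (cases "c = ?b")
    case True
    then show ?thesis by (simp add: lookup_add)
  next
    case False
    have "Poly_Mapping.lookup c j = 0" if "c - Poly_Mapping.single j 1 = a"
    proof (rule ccontr)
      assume "Poly_Mapping.lookup c j \<noteq> 0"
      then have "c = (c - Poly_Mapping.single j 1) + Poly_Mapping.single j 1"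
        by (intro poly_mapping_eqI) (auto simp: lookup_add lookup_minus lookup_single when_def)
      with that False show False by simp
    qed
    with False show ?thesis by (auto simp: lookup_single when_def)
  qed
  show ?thesis
    unfolding partial_deriv_def lookup_sum term_eq
    by (auto simp: sum.delta in_keys_iff)
qed

definition nabla :: "'d \<Rightarrow> 'd tuple \<Rightarrow> 'd tuple" where
  "nabla j S = (\<lambda>r. partial_deriv j (S r))"

definition gamma :: "'d::finite tuple \<Rightarrow> 'd rpoly ^ 'd" where
  "gamma S = (\<chi> r. S r)"

definition gamma_inv :: "'d::finite rpoly ^ 'd \<Rightarrow> 'd tuple" where
  "gamma_inv v = (\<lambda>r. v $ r)"

definition beta :: "'d::finite rpoly ^ 'd \<Rightarrow> 'd rpoly ^ 'd" where
  "beta v = (\<chi> r t. if r = t then 0 else 1) *v v"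

definition expansion :: "'d::finite \<Rightarrow> 'd tuple \<Rightarrow> 'd tuple" where
  "expansion j = gamma_inv \<circ> beta \<circ> gamma \<circ> nabla j"

lemma gamma_inv_gamma: "gamma_inv (gamma S) = S" "gamma (gamma_inv v) = v"
  by (simp_all add: gamma_def gamma_inv_def)

lemma expansion_entry: "expansion j S r = (\<Sum>t\<in>UNIV - {r}. partial_deriv j (S t))"
proof -
  have "expansion j S r = (\<Sum>t\<in>UNIV. (if r = t then 0 else 1) * partial_deriv j (S t))"
    by (simp add: expansion_def gamma_inv_def beta_def gamma_def nabla_def matrix_vector_mult_def)
  also have "\<dots> = (\<Sum>t\<in>UNIV - {r}. partial_deriv j (S t))"
    by (rule sum.mono_neutral_cong_right) auto
  finally show ?thesis .
qed

text \<open>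
  \<open>sub_expansion j k S l S'\<close> is the relation \<open>T\<^sup>k(S) \<le> T\<^sup>l(S')\<close> in the direction \<open>x\<^sub>j\<close>. It relates
  the pairs of an order and a tuple, not the values of the iterates; the order \<open>l\<close> on the
  right-hand side does not enter its defining condition.
\<close>

definition sub_expansion :: "'d::finite \<Rightarrow> nat \<Rightarrow> 'd tuple \<Rightarrow> nat \<Rightarrow> 'd tuple \<Rightarrow> bool" where
  "sub_expansion j k S l S' \<longleftrightarrow> (\<exists>m\<ge>0. (expansion j ^^ k) S = (expansion j ^^ (k + m)) S')"

text \<open>
  In the next two definitions the natural numbers start at \<open>1\<close>.

  \<open>exp_index j S S'\<close> is \<open>[T(S) : T(S')]\<close>. The value \<open>r\<close> is unique if \<open>T(S') \<noteq> 0\<close>; otherwise it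
  is understood to be the smallest one.
\<close>

definition exp_index :: "'d::finite \<Rightarrow> 'd tuple \<Rightarrow> 'd tuple \<Rightarrow> enat" where
  "exp_index j S S' =
     (if \<exists>r\<ge>1. expansion j S' = (expansion j ^^ r) S
      then enat (LEAST r. r \<ge> 1 \<and> expansion j S' = (expansion j ^^ r) S)
      else \<infinity>)"

text \<open>
  \<open>dominating_number j S S'\<close> is \<open>D[T(S) | T(S')]\<close>, meaningful if \<open>T(S) \<le> T(S')\<close>. The set of
  which the minimum is taken is never empty, as some iterate of \<open>T\<close> annihilates \<open>S\<close> and \<open>S'\<close>.
\<close>

definition dominating_number :: "'d::finite \<Rightarrow> 'd tuple \<Rightarrow> 'd tuple \<Rightarrow> nat" where
  "dominating_number j S S' = (LEAST s. s \<ge> 1 \<and> sub_expansion j s S' 1 S)"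

end

theory Submission
  imports Defs
begin

text \<open>
  Write \<open>T\<close> for the expansion in the direction \<open>x\<^sub>j\<close> and \<open>U\<^sub>i = T(S\<^sub>i)\<close>. The chain condition says
  that \<open>U\<^sub>i\<close> lies on the forward orbit of \<open>U\<^sub>i\<^sub>+\<^sub>1\<close> under \<open>T\<close>, and the index \<open>[U\<^sub>i\<^sub>+\<^sub>1 : U\<^sub>i]\<close> is one more
  than the first time at which this orbit reaches \<open>U\<^sub>i\<close>. Since \<open>T\<close> lowers the degree in \<open>x\<^sub>j\<close>, each
  orbit is injective until it is absorbed by the zero tuple
  (\<open>expansion_eventually_zero\<close>, \<open>funpow_collision\<close>).

  Injectivity before absorption makes first hitting times additive along the chain
  (\<open>hitting_time_add\<close>). Hence the sum of the \<open>n - k\<close> indices is \<open>a + (n - k)\<close>, where \<open>a\<close> is the first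
  time at which the orbit of \<open>U\<^sub>n\<close> reaches \<open>U\<^sub>k\<close>, and the claim reduces to \<open>a < s\<close> for the dominating
  number \<open>s\<close> (\<open>hitting_time_less_dominating_number\<close>). The condition defining \<open>s\<close> says that
  \<open>T\<^sup>s\<^sup>-\<^sup>1(U\<^sub>n)\<close> equals an iterate of \<open>U\<^sub>k = T\<^sup>a(U\<^sub>n)\<close>. If \<open>s \<le> a\<close>, this iterate is a strictly later
  point of the orbit of \<open>U\<^sub>n\<close>, so the orbit has already been absorbed at time \<open>s - 1 < a\<close>; then \<open>U\<^sub>k\<close>
  is zero and has been reached before its first hitting time, a contradiction.
\<close>

section \<open>Orbits absorbed by a fixed point\<close>

definition hitting_time :: "('a \<Rightarrow> 'a) \<Rightarrow> 'a \<Rightarrow> 'a \<Rightarrow> nat" where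
  "hitting_time T u v = (LEAST a. (T ^^ a) u = v)"

lemma funpow_hitting_time: "(T ^^ a) u = v \<Longrightarrow> (T ^^ hitting_time T u v) u = v"
  unfolding hitting_time_def by (rule LeastI)

lemma hitting_time_le: "(T ^^ a) u = v \<Longrightarrow> hitting_time T u v \<le> a"
  unfolding hitting_time_def by (rule Least_le)

lemma funpow_funpow: "(T ^^ a) ((T ^^ b) u) = (T ^^ (a + b)) u"
  by (simp add: funpow_add)

lemma funpow_fixed_point: "T z = z \<Longrightarrow> (T ^^ a) z = z"
  by (induction a) auto

lemma funpow_absorbed:
  assumes "T z = z" and "(T ^^ p) u = z" and "p \<le> a"
  shows "(T ^^ a) u = z"
proof -
  have "(T ^^ a) u = (T ^^ (a - p)) ((T ^^ p) u)"
    using \<open>p \<le> a\<close> by (simp add: funpow_funpow)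
  then show ?thesis
    using assms funpow_fixed_point by metis
qed

text \<open>
  A repeated point makes the orbit periodic, so the point recurs at arbitrarily late times, when the
  orbit is already constant.
\<close>

lemma funpow_collision:
  assumes "T z = z" and "(T ^^ p) u = z"
    and eq: "(T ^^ a) u = (T ^^ b) u" and "a < b"
  shows "(T ^^ a) u = z"
proof -
  have shift: "(T ^^ (b - a)) ((T ^^ a) u) = (T ^^ a) u"
    unfolding funpow_funpow using eq \<open>a < b\<close> by simp
  have "(T ^^ ((b - a) * p)) ((T ^^ a) u) = (T ^^ a) u"
    using funpow_fixed_point[where T = "T ^^ (b - a)", OF shift] by (simp add: funpow_mult)
  then have "(T ^^ a) u = (T ^^ ((b - a) * p + a)) u"
    by (simp add: funpow_add)
  moreover have "p \<le> (b - a) * p + a"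
    using \<open>a < b\<close> mult_le_mono1[of 1 "b - a" p] by linarith
  ultimately show ?thesis
    using funpow_absorbed assms(1,2) by metis
qed

text \<open>
  The composite time is always attained; it is the first one because an earlier visit to \<open>w\<close> would be
  a collision, forcing \<open>w\<close> to be the absorbing point \<open>z\<close>. Then either \<open>v\<close> reaches \<open>z\<close> too early, or
  \<open>v\<close> itself is \<open>z\<close> and is reached too early from \<open>u\<close>.
\<close>

lemma hitting_time_add:
  assumes "T z = z" and "(T ^^ p) u = z"
    and "(T ^^ a0) u = v" and "(T ^^ b0) v = w"
  shows "hitting_time T u w = hitting_time T u v + hitting_time T v w"
proof -
  let ?a = "hitting_time T u v" and ?b = "hitting_time T v w" and ?c = "hitting_time T u w"
  have a: "(T ^^ ?a) u = v" and b: "(T ^^ ?b) v = w"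
    using assms(3,4) by (blast intro: funpow_hitting_time)+
  then have ab: "(T ^^ (?b + ?a)) u = w"
    by (simp add: funpow_add)
  then have c: "(T ^^ ?c) u = w"
    by (rule funpow_hitting_time)
  have "\<not> ?c < ?b + ?a"
  proof
    assume less: "?c < ?b + ?a"
    have wz: "w = z"
      using funpow_collision[OF assms(1,2) _ less] ab c by simp
    show False
    proof (cases "?a \<le> ?c")
      case True
      have "(T ^^ (?c - ?a)) v = (T ^^ (?c - ?a)) ((T ^^ ?a) u)"
        by (simp add: a)
      also have "\<dots> = w"
        using True c by (simp add: funpow_funpow)
      finally have "?b \<le> ?c - ?a"
        by (rule hitting_time_le)
      with less True show False by simp
    next
      case False
      then have "v = z"
        using funpow_absorbed[where T = T, OF assms(1), of ?c u ?a] a c wz by simp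
      then have "?a \<le> ?c"
        using hitting_time_le[OF c] wz by simp
      with False show False by simp
    qed
  qed
  moreover have "?c \<le> ?b + ?a"
    using ab by (rule hitting_time_le)
  ultimately show ?thesis by simp
qed

section \<open>The expansion is locally nilpotent\<close>

lemma expansion_zero: "expansion j (\<lambda>_. 0) = (\<lambda>_. 0)"
  by (simp add: expansion_entry partial_deriv_def fun_eq_iff)

text \<open>
  The condition on \<open>N\<close> says that every entry has degree less than \<open>N\<close> in \<open>x\<^sub>j\<close>.
\<close>

lemma expansion_pow_eq_zero:
  assumes "\<And>t a. N \<le> Poly_Mapping.lookup a j \<Longrightarrow> Poly_Mapping.lookup (S t) a = 0"
  shows "(expansion j ^^ N) S = (\<lambda>_. 0)"
  using assms
proof (induction N arbitrary: S)
  case 0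
  then show ?case
    by (auto simp: fun_eq_iff intro: poly_mapping_eqI)
next
  case (Suc N)
  have "Poly_Mapping.lookup (expansion j S t) a = 0" if "N \<le> Poly_Mapping.lookup a j" for t a
    using that by (simp add: expansion_entry lookup_sum lookup_partial_deriv lookup_add Suc.prems)
  then have "(expansion j ^^ N) (expansion j S) = (\<lambda>_. 0)"
    by (rule Suc.IH)
  then show ?case
    by (simp add: funpow_swap1)
qed

lemma expansion_eventually_zero: "\<exists>p. (expansion j ^^ p) S = (\<lambda>_. 0)"
proof -
  define E where "E = (\<Union>t. (\<lambda>a. Poly_Mapping.lookup a j) ` Poly_Mapping.keys (S t))"
  have "finite E"
    by (simp add: E_def)
  then obtain N where N: "\<forall>e\<in>E. e < N"
    using finite_nat_set_iff_bounded by blast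
  have "Poly_Mapping.lookup (S t) a = 0" if "N \<le> Poly_Mapping.lookup a j" for t a
  proof (rule ccontr)
    assume "Poly_Mapping.lookup (S t) a \<noteq> 0"
    then have "Poly_Mapping.lookup a j \<in> E"
      by (auto simp: E_def in_keys_iff intro!: exI[of _ t])
    with N that show False by auto
  qed
  then show ?thesis
    using expansion_pow_eq_zero by blast
qed

section \<open>Index and dominating number as hitting times\<close>

lemma sub_expansion_one_iff:
  "sub_expansion j 1 S l S' \<longleftrightarrow> (\<exists>a. (expansion j ^^ a) (expansion j S') = expansion j S)"
  by (auto simp: sub_expansion_def funpow_swap1 eq_commute[of "expansion j S"])

lemma exp_index_eq_hitting_time:
  assumes "(expansion j ^^ a) (expansion j S) = expansion j S'"
  shows "exp_index j S S' =
    enat (Suc (hitting_time (expansion j) (expansion j S) (expansion j S')))"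
proof -
  let ?P = "\<lambda>r. r \<ge> 1 \<and> expansion j S' = (expansion j ^^ r) S"
  have shift: "?P (Suc r) \<longleftrightarrow> (expansion j ^^ r) (expansion j S) = expansion j S'" for r
    by (auto simp: funpow_swap1)
  with assms have P: "?P (Suc a)" by blast
  have "(LEAST r. ?P r) = Suc (LEAST r. ?P (Suc r))"
    by (rule Least_Suc[where P = ?P, OF P]) simp
  also have "\<dots> = Suc (hitting_time (expansion j) (expansion j S) (expansion j S'))"
    unfolding shift hitting_time_def ..
  finally show ?thesis
    using P unfolding exp_index_def by auto
qed

lemma hitting_time_less_dominating_number:
  assumes "(expansion j ^^ a0) (expansion j S') = expansion j S"
  shows "hitting_time (expansion j) (expansion j S') (expansion j S) < dominating_number j S S'"
proof -
  let ?T = "expansion j"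
  let ?a = "hitting_time ?T (?T S') (?T S)"
  let ?P = "\<lambda>s. s \<ge> 1 \<and> sub_expansion j s S' 1 S"
  obtain p q where p: "(?T ^^ p) S' = (\<lambda>_. 0)" and q: "(?T ^^ q) S = (\<lambda>_. 0)"
    using expansion_eventually_zero by metis
  have a: "(?T ^^ ?a) (?T S') = ?T S"
    using assms by (rule funpow_hitting_time)
  have p': "(?T ^^ p) (?T S') = (\<lambda>_. 0)"
    using funpow_absorbed[where T = ?T, OF expansion_zero p, of "Suc p"] by (simp add: funpow_swap1)
  have "(?T ^^ Suc (p + q)) S' = (?T ^^ (Suc (p + q) + 0)) S"
    using funpow_absorbed[where T = ?T, OF expansion_zero p, of "Suc (p + q)"]
      funpow_absorbed[where T = ?T, OF expansion_zero q, of "Suc (p + q)"] by simp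
  then have "?P (Suc (p + q))"
    unfolding sub_expansion_def by (metis le_add1 plus_1_eq_Suc zero_le)
  then have "?P (dominating_number j S S')"
    unfolding dominating_number_def by (rule LeastI)
  then obtain s m where s: "dominating_number j S S' = Suc s"
    and eq: "(?T ^^ Suc s) S' = (?T ^^ (Suc s + m)) S"
    unfolding sub_expansion_def by (metis Suc_le_D One_nat_def)
  have "(?T ^^ s) (?T S') = (?T ^^ (s + m)) ((?T ^^ ?a) (?T S'))"
    using eq by (simp add: a funpow_swap1)
  then have visit: "(?T ^^ s) (?T S') = (?T ^^ (s + m + ?a)) (?T S')"
    by (simp add: funpow_add)
  have "\<not> s < ?a"
  proof
    assume less: "s < ?a"
    have zero: "(?T ^^ s) (?T S') = (\<lambda>_. 0)"
      by (rule funpow_collision[OF expansion_zero p' visit]) (use less in simp)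
    then have "?T S = (\<lambda>_. 0)"
      using funpow_absorbed[where T = ?T, OF expansion_zero zero, of ?a] less a by simp
    then have "?a \<le> s"
      using hitting_time_le[OF zero] by simp
    with less show False by simp
  qed
  with s show ?thesis by simp
qed

theorem theorem11p5:
  fixes j :: "'d::finite" and S :: "nat \<Rightarrow> 'd tuple" and n k :: nat
  assumes "CARD('d) \<ge> 2"
    and "\<And>i. 1 \<le> i \<Longrightarrow> i < n \<Longrightarrow> sub_expansion j 1 (S i) 1 (S (i + 1))"
    and "1 \<le> k" and "k \<le> n"
  shows "(\<Sum>i = k + 1..n. exp_index j (S i) (S (i - 1)))
           < enat (dominating_number j (S k) (S n) + (n - k))"
proof -
  let ?T = "expansion j"
  let ?U = "\<lambda>i. ?T (S i)"
  have "(\<exists>a. (?T ^^ a) (?U l) = ?U k) \<and>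
    (\<Sum>i = k + 1..l. exp_index j (S i) (S (i - 1))) = enat (hitting_time ?T (?U l) (?U k) + (l - k))"
    if "k \<le> l" "l \<le> n" for l
    using that
  proof (induction l rule: dec_induct)
    case base
    have "(?T ^^ 0) (?U k) = ?U k" by simp
    then show ?case
      using hitting_time_le[of 0 ?T "?U k" "?U k"] by (auto simp: zero_enat_def intro: exI[of _ 0])
  next
    case (step l)
    then obtain b where b: "(?T ^^ b) (?U l) = ?U k" by auto
    have IH: "(\<Sum>i = k + 1..l. exp_index j (S i) (S (i - 1)))
        = enat (hitting_time ?T (?U l) (?U k) + (l - k))"
      using step by simp
    have "sub_expansion j 1 (S l) 1 (S (Suc l))"
      using assms(2)[of l] assms(3) step by simp
    then obtain a where a: "(?T ^^ a) (?U (Suc l)) = ?U l"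
      using sub_expansion_one_iff by blast
    obtain p where p: "(?T ^^ p) (?U (Suc l)) = (\<lambda>_. 0)"
      using expansion_eventually_zero by blast
    have "(?T ^^ (b + a)) (?U (Suc l)) = ?U k"
      using a b by (simp add: funpow_add)
    moreover have "hitting_time ?T (?U (Suc l)) (?U k) =
        hitting_time ?T (?U (Suc l)) (?U l) + hitting_time ?T (?U l) (?U k)"
      using hitting_time_add[where T = ?T, OF expansion_zero p a b] .
    ultimately show ?case
      using IH exp_index_eq_hitting_time[OF a] step(1)
      by (auto simp: Suc_diff_le add_ac simp del: One_nat_def)
  qed
  then have "\<exists>a. (?T ^^ a) (?U n) = ?U k"
    and "(\<Sum>i = k + 1..n. exp_index j (S i) (S (i - 1))) =
      enat (hitting_time ?T (?U n) (?U k) + (n - k))"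
    using assms(4) by auto
  then show ?thesis
    using hitting_time_less_dominating_number by fastforce
qed

end
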